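(* Let $1<p<\infty$, $\alpha\in\mathbb{R}$, let $v$ be a weight function on $\mathbb{R}$, and let $\phi\in L^1(\mathbb{R})$. Suppose that for some constant $c>0$, $$\sup_{y\in\mathbb{R}}\frac{v(ty)}{v(y)}\le c\,\inf_{y\in\mathbb{R}}\frac{v(ty)}{v(y)}\qquad\text{for all } t\in\mathbb{R}\setminus\{0\}.$$ Put $$A_{\sup}:=\int_{\mathbb{R}} \frac{|\phi(t)|}{|t|^{2\alpha+2-\frac1p}}\left(\sup_{y\in\mathbb{R}}\frac{v(ty)}{v(y)}\right)^{1/p}dt .$$ Then the operator $H_{\alpha,\phi}:L^p_v(\mathbb{R})\to L^p_v(\mathbb{R})$ is bounded if and only if $A_{\sup}<\infty$, and moreover $$\frac1c A_{\sup}\le \|H_{\alpha,\phi}\|_{L^p_v(\mathbb{R})\to L^p_v(\mathbb{R})}\le A_{\sup}.$$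
   Context: A weight function on $\mathbb{R}$ is a measurable function $v:\mathbb{R}\to[0,\infty]$ that is positive and finite almost everywhere. $L^p_v(\mathbb{R})$ is the weighted Lebesgue space with norm $\|f\|_{L^p_v(\mathbb{R})}=\left(\int_{\mathbb{R}}|f(x)|^p v(x)\,dx\right)^{1/p}$. The Dunkl-Hausdorff operator is $$H_{\alpha,\phi}f(x)=\int_{\mathbb{R}}\frac{|\phi(t)|}{|t|^{2\alpha+2}}f\left(\frac{x}{t}\right)dt .$$ It is bounded on $L^p_v(\mathbb{R})$ if for every $f\in L^p_v(\mathbb{R})$ the integral converges absolutely for a.e. $x$ and there is a finite constant $C$ with $\|H_{\alpha,\phi}f\|_{L^p_v(\mathbb{R})}\le C\|f\|_{L^p_v(\mathbb{R})}$ for all such $f$; the operator norm is the least such $C$ (and is $\infty$ if the operator is not bounded). Since weights are positive and finite only a.e., $\sup_y$ and $\inf_y$ are the essential supremum and essential infimum over $y$. *)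

theory Defs
  imports "HOL-Probability.Essential_Supremum"
begin

text \<open>Real powers on \<open>[0,\<infinity>]\<close>, meant for exponents \<open>a > 0\<close> only.\<close>

definition epowr :: "ennreal \<Rightarrow> real \<Rightarrow> ennreal" where
  "epowr x a = (if x = \<infinity> then \<infinity> else ennreal (enn2real x powr a))"

definition weight_function :: "(real \<Rightarrow> ennreal) \<Rightarrow> bool" where
  "weight_function v \<longleftrightarrow>
     v \<in> borel_measurable lebesgue \<and> (AE x in lebesgue. 0 < v x \<and> v x < \<infinity>)"

text \<open>Functions are not identified up to null sets, so the norm below is only a seminorm.\<close>

definition weighted_norm ::
    "real \<Rightarrow> (real \<Rightarrow> ennreal) \<Rightarrow> (real \<Rightarrow> 'a::real_normed_vector) \<Rightarrow> ennreal" where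
  "weighted_norm p v f =
     epowr (\<integral>\<^sup>+ x. ennreal (norm (f x) powr p) * v x \<partial>lebesgue) (1 / p)"

definition weighted_Lp ::
    "real \<Rightarrow> (real \<Rightarrow> ennreal) \<Rightarrow> (real \<Rightarrow> 'a::real_normed_vector) set" where
  "weighted_Lp p v = {f \<in> borel_measurable lebesgue. weighted_norm p v f < \<infinity>}"

text \<open>
  Formulas below involving \<open>t\<close> are evaluated by HOL conventions at the single point
  \<open>t = 0\<close> (division by zero gives zero); this is a null set for every integral over \<open>t\<close>.
\<close>

definition dunkl_hausdorff_integrand ::
    "real \<Rightarrow> (real \<Rightarrow> 'a) \<Rightarrow> (real \<Rightarrow> 'a) \<Rightarrow> real \<Rightarrow> real
       \<Rightarrow> 'a::{real_normed_field, banach, second_countable_topology}" where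
  "dunkl_hausdorff_integrand \<alpha> \<phi> f x t =
     (norm (\<phi> t) / \<bar>t\<bar> powr (2 * \<alpha> + 2)) *\<^sub>R f (x / t)"

definition dunkl_hausdorff ::
    "real \<Rightarrow> (real \<Rightarrow> 'a) \<Rightarrow> (real \<Rightarrow> 'a) \<Rightarrow> real
       \<Rightarrow> 'a::{real_normed_field, banach, second_countable_topology}" where
  "dunkl_hausdorff \<alpha> \<phi> f x = (\<integral> t. dunkl_hausdorff_integrand \<alpha> \<phi> f x t \<partial>lebesgue)"

definition dunkl_hausdorff_bounds ::
    "real \<Rightarrow> (real \<Rightarrow> ennreal) \<Rightarrow> real
       \<Rightarrow> (real \<Rightarrow> 'a::{real_normed_field, banach, second_countable_topology}) \<Rightarrow> real set" where
  "dunkl_hausdorff_bounds p v \<alpha> \<phi> =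
     {C. 0 \<le> C \<and> (\<forall>f \<in> weighted_Lp p v.
        weighted_norm p v (dunkl_hausdorff \<alpha> \<phi> f) \<le> ennreal C * weighted_norm p v f)}"

text \<open>
  Bochner integrability is absolute convergence. Membership of the image in the space
  adds to the norm bound only the measurability without which the norm has no meaning.
\<close>

definition dunkl_hausdorff_bounded ::
    "real \<Rightarrow> (real \<Rightarrow> ennreal) \<Rightarrow> real
       \<Rightarrow> (real \<Rightarrow> 'a::{real_normed_field, banach, second_countable_topology}) \<Rightarrow> bool" where
  "dunkl_hausdorff_bounded p v \<alpha> \<phi> \<longleftrightarrow>
     (\<forall>f \<in> weighted_Lp p v.
        (AE x in lebesgue. integrable lebesgue (dunkl_hausdorff_integrand \<alpha> \<phi> f x)) \<and>
        dunkl_hausdorff \<alpha> \<phi> f \<in> weighted_Lp p v) \<and>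
     dunkl_hausdorff_bounds p v \<alpha> \<phi> \<noteq> {}"

definition dunkl_hausdorff_norm ::
    "real \<Rightarrow> (real \<Rightarrow> ennreal) \<Rightarrow> real
       \<Rightarrow> (real \<Rightarrow> 'a::{real_normed_field, banach, second_countable_topology}) \<Rightarrow> ennreal" where
  "dunkl_hausdorff_norm p v \<alpha> \<phi> =
     (if dunkl_hausdorff_bounded p v \<alpha> \<phi>
      then (INF C \<in> dunkl_hausdorff_bounds p v \<alpha> \<phi>. ennreal C) else \<infinity>)"

text \<open>Dual of \<^const>\<open>esssup\<close>, with the same treatment of non-measurable functions.\<close>

definition essinf :: "'a measure \<Rightarrow> ('a \<Rightarrow> ennreal) \<Rightarrow> ennreal" where
  "essinf M f = (if f \<in> borel_measurable M then Liminf (ae_filter M) f else 0)"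

definition dilation_sup :: "(real \<Rightarrow> ennreal) \<Rightarrow> real \<Rightarrow> ennreal" where
  "dilation_sup v t = esssup lebesgue (\<lambda>y. v (t * y) / v y)"

definition dilation_inf :: "(real \<Rightarrow> ennreal) \<Rightarrow> real \<Rightarrow> ennreal" where
  "dilation_inf v t = essinf lebesgue (\<lambda>y. v (t * y) / v y)"

definition A_sup ::
    "real \<Rightarrow> (real \<Rightarrow> ennreal) \<Rightarrow> real \<Rightarrow> (real \<Rightarrow> 'a::real_normed_vector) \<Rightarrow> ennreal" where
  "A_sup p v \<alpha> \<phi> =
     (\<integral>\<^sup>+ t. ennreal (norm (\<phi> t) / \<bar>t\<bar> powr (2 * \<alpha> + 2 - 1 / p))
            * epowr (dilation_sup v t) (1 / p) \<partial>lebesgue)"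

end

theory Submission
  imports Defs
begin

text \<open>
  Write \<open>D(t)\<close> for the essential supremum of \<open>v(ty)/v(y)\<close> over \<open>y\<close>. The operator averages the
  dilates \<open>f(x/t)\<close>, and \<open>D\<close> measures how much one dilation costs: by the substitution \<open>x = ty\<close>, the
  integral of \<open>|f(x/t)|^p v(x)\<close> over \<open>x\<close> is \<open>|t|\<close> times the integral of \<open>|f(y)|^p v(ty)\<close> over \<open>y\<close>, which
  is at most \<open>|t| D(t) \<parallel>f\<parallel>^p\<close>.

  The upper bound is therefore Minkowski's integral inequality: the norm of an average of
  dilates is at most the average of \<open>(|t| D(t))^(1/p) \<parallel>f\<parallel>\<close>, which is \<open>A_sup \<parallel>f\<parallel>\<close>. Since the norms of
  the dilates are known up to the factor \<open>b(t) = (|t| D(t))^(1/p)\<close>, no duality is involved: Jensen's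
  inequality for the measure with density \<open>|\<phi>(t)| |t|^(-2\<alpha>-2) b(t)\<close>, applied to \<open>f(x/t)/b(t)\<close>,
  followed by Tonelli, is enough (\<open>nn_integral_powr_Jensen\<close>, \<open>weighted_dilation_average_le\<close>).

  For the lower bound, the hypothesis says that dilating by \<open>t\<close> multiplies \<open>v\<close> by \<open>D(t)\<close> up to the
  factor \<open>c\<close>. So the functions \<open>v^(-1/p) |x|^(-1/p)\<close>, which just fail to lie in the space, are
  approximate eigenfunctions of every dilation, with factor at least \<open>(|t| D(t) / c)^(1/p)\<close>. Cutting
  them off at \<open>|x| \<le> 1\<close> and adding \<open>-e\<close> to the exponent puts them in the space; comparing norms over
  \<open>|x| > R\<close> loses only a factor \<open>R^(-e)\<close> and the values \<open>|t| \<ge> R\<close> (\<open>truncated_lower_bound\<close>). With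
  \<open>R = n\<close> and \<open>e = 1/n\<close> the loss disappears as \<open>n\<close> grows, and Fatou's lemma gives
  \<open>A_sup \<le> c^(1/p) C\<close> for every admissible bound \<open>C\<close> (\<open>A_sup_le_bound\<close>). The factor \<open>1/c\<close> follows because \<open>c \<ge> 1\<close>, as
  \<open>t = 1\<close> shows.

  The rest is measure theory. Lebesgue measurable data are replaced by Borel measurable
  representatives, so that Fubini's theorem applies to functions of \<open>(x, t)\<close> such as \<open>f(x/t)\<close>; the
  exceptional null sets are harmless because dilations preserve null sets. The hypothesis also
  forces \<open>0 < D(t) < \<infinity>\<close> for \<open>t \<noteq> 0\<close>, so \<open>D\<close> may be taken real-valued.
\<close>

section \<open>Borel representatives of Lebesgue measurable functions\<close>

text \<open>
  The preimages of a countable basis are Borel sets up to null sets. Off the union of the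
  countably many exceptional sets the function is thus Borel measurable, and on that union it
  is made constant.
\<close>

lemma completion_borel_representative:
  fixes f :: "'a \<Rightarrow> 'b::second_countable_topology"
  assumes f: "f \<in> borel_measurable (completion M)"
  obtains g where "g \<in> borel_measurable M" "AE x in M. f x = g x"
proof -
  obtain B :: "'b set set" where B: "countable B" "topological_basis B"
    using ex_countable_basis by blast
  have meas: "f -` b \<inter> space M \<in> completion M" if "b \<in> B" for b
    using measurable_sets[OF f, of b] topological_basis_open[OF B(2) that] by auto
  define m where "m b = main_part M (f -` b \<inter> space M)" for b
  have m: "m b \<in> sets M" if "b \<in> B" for b
    unfolding m_def using meas[OF that] by (rule main_part_sets)
  have "AE x in M. \<forall>b\<in>B. x \<in> m b \<longleftrightarrow> x \<in> f -` b \<inter> space M"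
    unfolding m_def AE_ball_countable[OF B(1)] by (intro ballI AE_in_main_part meas)
  from AE_E3[OF this] obtain N where N: "N \<in> null_sets M"
    and sub: "\<And>x. x \<in> space M - N \<Longrightarrow> \<forall>b\<in>B. x \<in> m b \<longleftrightarrow> x \<in> f -` b \<inter> space M"
    by metis
  define g where "g x = (if x \<in> N then undefined else f x)" for x
  have "g \<in> borel_measurable M"
  proof (rule borel_measurableI)
    fix S :: "'b set" assume "open S"
    then obtain B' where B': "B' \<subseteq> B" "S = \<Union>B'"
      using B(2) unfolding topological_basis_def by blast
    have "countable B'" using B' B(1) countable_subset by blast
    have "g -` S \<inter> space M
        = (if undefined \<in> S then N else {}) \<union> ((\<Union>b\<in>B'. m b) \<inter> space M - N)"
      (is "?L = ?R")
    proof (rule set_eqI)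
      fix x
      show "x \<in> ?L \<longleftrightarrow> x \<in> ?R"
      proof (cases "x \<in> N")
        case True
        then have "x \<in> space M" using sets.sets_into_space[OF null_setsD2[OF N]] by blast
        with True show ?thesis by (simp add: g_def)
      next
        case False
        have "f x \<in> S \<longleftrightarrow> (\<exists>b\<in>B'. x \<in> m b)" if "x \<in> space M"
        proof -
          have "\<forall>b\<in>B. x \<in> m b \<longleftrightarrow> f x \<in> b" using sub False that by blast
          then show ?thesis using B' by blast
        qed
        with False show ?thesis by (auto simp: g_def)
      qed
    qed
    also have "\<dots> \<in> sets M"
      using N B' m \<open>countable B'\<close> by (auto intro!: sets.Un sets.Diff sets.Int sets.countable_UN')
    finally show "g -` S \<inter> space M \<in> sets M" .
  qed
  moreover have "AE x in M. f x = g x"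
    using AE_not_in[OF N] by eventually_elim (simp add: g_def)
  ultimately show thesis by (rule that)
qed

lemma completion_measurable_AE_cong:
  assumes f: "f \<in> borel_measurable (completion M)" and ae: "AE x in M. f x = g x"
  shows "g \<in> borel_measurable (completion M)"
proof (rule measurableI)
  fix A :: "'b set" assume A: "A \<in> sets borel"
  have [measurable]: "Measurable.pred (completion M) (\<lambda>x. f x \<noteq> g x)"
      "Measurable.pred (completion M) (\<lambda>x. g x \<in> A \<and> f x \<noteq> g x)"
    using ae by (intro sets_completion_AE; eventually_elim; simp)+
  have [measurable]: "Measurable.pred (completion M) (\<lambda>x. f x \<in> A)"
    using f A by measurable
  have "g -` A \<inter> space (completion M)
    = {x \<in> space (completion M). (f x \<in> A \<and> \<not> f x \<noteq> g x) \<or> (g x \<in> A \<and> f x \<noteq> g x)}"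
    by auto
  also have "\<dots> \<in> sets (completion M)" by measurable
  finally show "g -` A \<inter> space (completion M) \<in> sets (completion M)" .
qed simp

section \<open>Dilations and null sets\<close>

lemma nn_integral_scale:
  fixes f :: "real \<Rightarrow> ennreal"
  assumes "f \<in> borel_measurable borel" "t \<noteq> 0"
  shows "(\<integral>\<^sup>+ x. f x \<partial>lborel) = ennreal \<bar>t\<bar> * (\<integral>\<^sup>+ x. f (t * x) \<partial>lborel)"
  using nn_integral_real_affine[OF assms, of 0] by simp

lemma AE_lborel_scale:
  fixes t :: real
  assumes "AE y in lborel. P y" "t \<noteq> 0"
  shows "AE y in lborel. P (t * y)"
proof -
  obtain N where N: "N \<in> null_sets lborel" "\<And>y. y \<notin> N \<Longrightarrow> P y"
    using AE_E3[OF assms(1)] by auto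
  have [measurable]: "N \<in> sets borel" using N(1) by auto
  have "emeasure lborel N = (\<integral>\<^sup>+ x. indicator N x \<partial>lborel)" by simp
  also have "\<dots> = ennreal \<bar>t\<bar> * (\<integral>\<^sup>+ x. indicator N (t * x) \<partial>lborel)"
    by (rule nn_integral_scale) (use assms in auto)
  finally have "(\<integral>\<^sup>+ x. (indicator N (t * x) :: ennreal) \<partial>lborel) = 0"
    using N(1) assms(2) by auto
  then have "AE x in lborel. (indicator N (t * x) :: ennreal) = 0"
    by (subst (asm) nn_integral_0_iff_AE) auto
  then show ?thesis
    by eventually_elim (rule N(2), simp add: indicator_eq_0_iff)
qed

lemma AE_lborel_commute:
  assumes [measurable]: "Measurable.pred (borel \<Otimes>\<^sub>M borel) (\<lambda>z. P (fst z) (snd z))"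
    and "AE t in lborel. AE x in lborel. P t x"
  shows "AE x in lborel. AE t in lborel. P (t::real) (x::real)"
proof -
  have "Measurable.pred (lborel \<Otimes>\<^sub>M lborel) (\<lambda>z. P (fst z) (snd z))"
    using assms(1) by (simp cong: measurable_cong_sets)
  then have "{z \<in> space (lborel \<Otimes>\<^sub>M lborel). P (fst z) (snd z)} \<in> sets (lborel \<Otimes>\<^sub>M lborel)"
    by (simp add: pred_def)
  from lborel_pair.AE_commute[OF this] assms(2) show ?thesis by simp
qed

text \<open>
  By Fubini: for fixed \<open>t \<noteq> 0\<close> the map \<open>x \<mapsto> x / t\<close> is a dilation, so the exceptional set is null in
  \<open>x\<close> for almost every \<open>t\<close>, hence null in \<open>t\<close> for almost every \<open>x\<close>. This is what makes the operator
  insensitive to changes of \<open>f\<close> on null sets.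
\<close>

lemma AE_lborel_quotient:
  assumes "AE y in lborel. P (y::real)"
  shows "AE x in lborel. AE t in lborel. P (x / t)"
proof -
  obtain N where N: "N \<in> null_sets lborel" "\<And>y. y \<notin> N \<Longrightarrow> P y"
    using AE_E3[OF assms(1)] by auto
  have [measurable]: "N \<in> sets borel" using N(1) by auto
  have "AE t in lborel. AE x in lborel. x / t \<notin> N"
    using AE_lborel_singleton[of "0 :: real"]
  proof eventually_elim
    case (elim t)
    then show ?case
      using AE_lborel_scale[OF AE_not_in[OF N(1)], of "1 / t"] by simp
  qed
  then have "AE x in lborel. AE t in lborel. x / t \<notin> N"
    by (rule AE_lborel_commute[rotated]) measurable
  then show ?thesis
    by (rule eventually_mono) (erule eventually_mono, rule N(2))
qed

lemma weight_borel_version: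
  assumes "weight_function v"
  obtains w :: "real \<Rightarrow> real" where "w \<in> borel_measurable borel" "\<And>x. 0 < w x"
    "AE x in lborel. v x = ennreal (w x)"
proof -
  from assms have v: "v \<in> borel_measurable lebesgue" and
    pos: "AE x in lborel. 0 < v x \<and> v x < \<infinity>"
    unfolding weight_function_def AE_completion_iff by blast+
  obtain u where [measurable]: "u \<in> borel_measurable lborel" and u: "AE x in lborel. v x = u x"
    using completion_borel_representative[OF v] .
  define w where "w x = (if 0 < u x \<and> u x < \<infinity> then enn2real (u x) else 1)" for x
  have "w \<in> borel_measurable borel" unfolding w_def by measurable
  moreover have "0 < w x" for x
    by (auto simp: w_def enn2real_positive_iff)
  moreover have "AE x in lborel. v x = ennreal (w x)"
    using u pos by eventually_elim (auto simp: w_def)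
  ultimately show thesis by (rule that)
qed


section \<open>Real powers of extended nonnegative numbers\<close>

lemma epowr_ennreal: "0 \<le> r \<Longrightarrow> epowr (ennreal r) a = ennreal (r powr a)"
  by (simp add: epowr_def)

lemma epowr_top [simp]: "epowr \<infinity> a = \<infinity>" "epowr top a = \<infinity>"
  by (simp_all add: epowr_def)

lemma epowr_less_top_iff: "epowr x a < \<infinity> \<longleftrightarrow> x < \<infinity>"
  by (simp add: epowr_def less_top)

lemma epowr_mono: "0 \<le> a \<Longrightarrow> x \<le> y \<Longrightarrow> epowr x a \<le> epowr y a"
  by (cases x; cases y) (auto simp: epowr_ennreal powr_mono2 top_unique)

lemma epowr_le_cmult_iff:
  assumes "0 < p" "0 \<le> C"
  shows "epowr x (1 / p) \<le> ennreal C * epowr y (1 / p) \<longleftrightarrow> x \<le> ennreal (C powr p) * y"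
proof (cases y)
  case (real r)
  show ?thesis
  proof (cases x)
    case (real s)
    have "s powr (1 / p) \<le> C * r powr (1 / p) \<longleftrightarrow> s \<le> C powr p * r"
    proof
      assume "s powr (1 / p) \<le> C * r powr (1 / p)"
      then have "(s powr (1 / p)) powr p \<le> (C * r powr (1 / p)) powr p"
        using assms by (intro powr_mono2) auto
      then show "s \<le> C powr p * r"
        using assms \<open>0 \<le> r\<close> \<open>0 \<le> s\<close> by (simp add: powr_mult powr_powr)
    next
      assume "s \<le> C powr p * r"
      then have "s powr (1 / p) \<le> (C powr p * r) powr (1 / p)"
        using assms \<open>0 \<le> s\<close> by (intro powr_mono2) auto
      then show "s powr (1 / p) \<le> C * r powr (1 / p)"
        using assms \<open>0 \<le> r\<close> by (simp add: powr_mult powr_powr)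
    qed
    then show ?thesis
      using real \<open>y = ennreal r\<close> \<open>0 \<le> r\<close> assms by (simp add: epowr_ennreal flip: ennreal_mult)
  qed (use real in \<open>simp add: epowr_ennreal ennreal_mult_eq_top_iff top_unique\<close>)
next
  case top
  then show ?thesis
    using assms
    by (cases "C = 0"; cases x) (simp_all add: epowr_def ennreal_mult_top split: if_splits)
qed

section \<open>Minkowski's inequality for averages of dilates\<close>

text \<open>
  The tangent to \<open>h \<mapsto> h powr p\<close> at \<open>a\<close> lies below the graph. Young's inequality for the conjugate
  exponents \<open>p\<close> and \<open>q = p / (p - 1)\<close> is this statement after rescaling.
\<close>

lemma Young_tangent:
  fixes a h p :: real
  assumes "1 < p" "0 \<le> a" "0 \<le> h"
  shows "p * a powr (p - 1) * h \<le> h powr p + (p - 1) * a powr p"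
proof -
  define q where "q = p / (p - 1)"
  have q: "1 < q" "1 / p + 1 / q = 1" "(p - 1) * q = p" "p / q = p - 1"
    using assms(1) by (auto simp: q_def field_simps)
  have "h * a powr (p - 1) \<le> h powr p / p + (a powr (p - 1)) powr q / q"
    by (rule Youngs_inequality) (use assms q in auto)
  also have "(a powr (p - 1)) powr q = a powr p"
    by (simp add: powr_powr q)
  finally have "p * (h * a powr (p - 1)) \<le> p * (h powr p / p + a powr p / q)"
    using assms(1) by (intro mult_left_mono) auto
  also have "\<dots> = h powr p + (p / q) * a powr p"
    using assms(1) by (simp add: field_simps)
  finally show ?thesis by (simp add: q mult_ac)
qed

text \<open>
  Jensen's inequality for the density \<open>W\<close> of total mass at most \<open>B\<close>: integrate the tangent
  inequality and choose the point of contact \<open>a\<close> to be the mean value of \<open>h\<close> relative to \<open>B\<close>.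
  Stating it for extended integrals lets it prove finiteness as well as bound norms.
\<close>

lemma nn_integral_powr_Jensen:
  fixes W h :: "'a \<Rightarrow> real"
  assumes "1 < p" and [measurable]: "W \<in> borel_measurable M" "h \<in> borel_measurable M"
    and W: "\<And>x. 0 \<le> W x" and h: "\<And>x. 0 \<le> h x"
    and "0 < B" and B: "(\<integral>\<^sup>+ x. ennreal (W x) \<partial>M) \<le> ennreal B"
  shows "epowr (\<integral>\<^sup>+ x. ennreal (W x * h x) \<partial>M) p
    \<le> ennreal (B powr (p - 1)) * (\<integral>\<^sup>+ x. ennreal (W x * h x powr p) \<partial>M)"
    (is "epowr ?S p \<le> _ * ?I")
proof -
  have tangent: "ennreal (p * a powr (p - 1)) * ?S \<le> ?I + ennreal ((p - 1) * a powr p * B)"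
    if "0 \<le> a" for a
  proof -
    have "ennreal (p * a powr (p - 1)) * ?S
        = (\<integral>\<^sup>+ x. ennreal (p * a powr (p - 1)) * ennreal (W x * h x) \<partial>M)"
      by (rule nn_integral_cmult[symmetric]) measurable
    also have "\<dots> \<le> (\<integral>\<^sup>+ x. ennreal (W x * h x powr p)
                        + ennreal ((p - 1) * a powr p) * ennreal (W x) \<partial>M)"
    proof (rule nn_integral_mono)
      fix x
      have "W x * (p * a powr (p - 1) * h x) \<le> W x * (h x powr p + (p - 1) * a powr p)"
        by (intro mult_left_mono Young_tangent W) (use assms(1) that h in auto)
      then have "p * a powr (p - 1) * (W x * h x) \<le> W x * h x powr p + (p - 1) * a powr p * W x"
        by (simp add: algebra_simps)
      then have "ennreal (p * a powr (p - 1) * (W x * h x))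
          \<le> ennreal (W x * h x powr p + (p - 1) * a powr p * W x)"
        by (rule ennreal_leI)
      then show "ennreal (p * a powr (p - 1)) * ennreal (W x * h x)
          \<le> ennreal (W x * h x powr p) + ennreal ((p - 1) * a powr p) * ennreal (W x)"
        using W[of x] h[of x] assms(1) by (simp add: ennreal_mult)
    qed
    also have "\<dots> = ?I + ennreal ((p - 1) * a powr p) * (\<integral>\<^sup>+ x. ennreal (W x) \<partial>M)"
      by (simp add: nn_integral_add nn_integral_cmult)
    also have "\<dots> \<le> ?I + ennreal ((p - 1) * a powr p) * ennreal B"
      by (intro add_left_mono mult_left_mono B) auto
    finally show ?thesis
      using assms(1,6) that by (simp add: ennreal_mult)
  qed
  show ?thesis
  proof (cases "?I = \<infinity>")
    case True
    then show ?thesis using \<open>0 < B\<close> by (simp add: ennreal_mult_top)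
  next
    case False
    then obtain i where i: "?I = ennreal i" "0 \<le> i" by (cases ?I) auto
    \<comment> \<open>Any fixed point of contact turns finiteness of the right-hand side into finiteness of the left.\<close>
    have "?S \<noteq> \<infinity>"
      using tangent[of 1] assms(1) by (auto simp: i ennreal_mult_top top_unique)
    then obtain s where s: "?S = ennreal s" "0 \<le> s" by (cases ?S) auto
    define a where "a = s / B"
    have a: "0 \<le> a" "s = a * B" using s \<open>0 < B\<close> by (auto simp: a_def)
    have apow: "a powr (p - 1) * a = a powr p"
      using a(1) by (cases "a = 0") (simp_all add: powr_diff)
    have "ennreal (p * a powr (p - 1) * s) \<le> ennreal (i + (p - 1) * a powr p * B)"
      using tangent[OF a(1)] i s assms(1) a(1) \<open>0 < B\<close>
      by (simp add: ennreal_mult ennreal_plus)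
    then have "p * a powr (p - 1) * s \<le> i + (p - 1) * a powr p * B"
      using i assms(1) \<open>0 < B\<close> by (subst (asm) ennreal_le_iff) auto
    moreover have "p * a powr (p - 1) * s = p * (a powr p * B)"
      by (simp add: a(2) apow[symmetric])
    ultimately have "a powr p * B \<le> i" by (simp only:) (simp add: algebra_simps)
    then have "B powr (p - 1) * (a powr p * B) \<le> B powr (p - 1) * i"
      by (intro mult_left_mono) auto
    moreover have "s powr p = B powr (p - 1) * (a powr p * B)"
      using a \<open>0 < B\<close> by (simp add: powr_mult powr_diff)
    ultimately show ?thesis
      using i s by (simp add: epowr_ennreal flip: ennreal_mult)
  qed
qed

text \<open>
  Here \<open>(\<bar>t\<bar> * d t) powr (1 / p)\<close> bounds the norm of the dilation by \<open>t\<close>, by the substitution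
  \<open>x = t * y\<close>. Weighting Jensen's inequality with that bound makes every dilate contribute the same
  amount, so that the remaining integral over \<open>t\<close> is again at most \<open>A\<close>.
\<close>

lemma weighted_dilation_average_le:
  fixes k g w d :: "real \<Rightarrow> real"
  assumes p: "1 < p" and A: "0 < A"
    and [measurable]: "k \<in> borel_measurable borel" "g \<in> borel_measurable borel"
      "w \<in> borel_measurable borel" "d \<in> borel_measurable borel"
    and k: "\<And>t. 0 \<le> k t" and g: "\<And>y. 0 \<le> g y" and w: "\<And>y. 0 \<le> w y"
    and d: "\<And>t. t \<noteq> 0 \<Longrightarrow> 0 < d t"
    and wd: "\<And>t. t \<noteq> 0 \<Longrightarrow> AE y in lborel. w (t * y) \<le> d t * w y"
    and kA: "(\<integral>\<^sup>+ t. ennreal (k t * (\<bar>t\<bar> * d t) powr (1 / p)) \<partial>lborel) \<le> ennreal A"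
  shows "(\<integral>\<^sup>+ x. epowr (\<integral>\<^sup>+ t. ennreal (k t * g (x / t)) \<partial>lborel) p * ennreal (w x) \<partial>lborel)
    \<le> ennreal (A powr p) * (\<integral>\<^sup>+ y. ennreal (g y powr p * w y) \<partial>lborel)"
    (is "?L \<le> _ * ?N")
proof -
  define b where "b t = (\<bar>t\<bar> * d t) powr (1 / p)" for t
  have [measurable]: "b \<in> borel_measurable borel" unfolding b_def by measurable
  have b0: "0 \<le> b t" for t by (simp add: b_def)
  have b: "0 < b t" "b t powr p = \<bar>t\<bar> * d t" if "t \<noteq> 0" for t
    using d[OF that] that p by (auto simp: b_def powr_powr)
  define K where "K x t = k t * b t * (g (x / t) / b t) powr p * w x" for x t
  have [measurable]: "(\<lambda>(x, t). ennreal (K x t)) \<in> borel_measurable (lborel \<Otimes>\<^sub>M lborel)"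
    unfolding K_def by measurable
  have "?L \<le> (\<integral>\<^sup>+ x. ennreal (A powr (p - 1)) * (\<integral>\<^sup>+ t. ennreal (K x t) \<partial>lborel) \<partial>lborel)"
  proof (rule nn_integral_mono)
    fix x
    have "(\<integral>\<^sup>+ t. ennreal (k t * g (x / t)) \<partial>lborel)
        = (\<integral>\<^sup>+ t. ennreal ((k t * b t) * (g (x / t) / b t)) \<partial>lborel)"
      by (rule nn_integral_cong_AE)
        (use AE_lborel_singleton[of "0 :: real"] in \<open>eventually_elim, use b(1) in force\<close>)
    then have "epowr (\<integral>\<^sup>+ t. ennreal (k t * g (x / t)) \<partial>lborel) p
        \<le> ennreal (A powr (p - 1)) *
          (\<integral>\<^sup>+ t. ennreal ((k t * b t) * (g (x / t) / b t) powr p) \<partial>lborel)"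
      using p A k g b0 kA
      by (simp only:) (rule nn_integral_powr_Jensen, auto simp: b_def)
    then have "epowr (\<integral>\<^sup>+ t. ennreal (k t * g (x / t)) \<partial>lborel) p * ennreal (w x)
        \<le> ennreal (A powr (p - 1)) *
          (\<integral>\<^sup>+ t. ennreal ((k t * b t) * (g (x / t) / b t) powr p) \<partial>lborel) * ennreal (w x)"
      by (rule mult_right_mono) simp
    also have "\<dots> = ennreal (A powr (p - 1)) *
          (\<integral>\<^sup>+ t. ennreal ((k t * b t) * (g (x / t) / b t) powr p) * ennreal (w x) \<partial>lborel)"
      by (simp add: nn_integral_multc mult.assoc)
    also have "\<dots> = ennreal (A powr (p - 1)) * (\<integral>\<^sup>+ t. ennreal (K x t) \<partial>lborel)"
      using k b0 w by (simp add: K_def ennreal_mult)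
    finally show "epowr (\<integral>\<^sup>+ t. ennreal (k t * g (x / t)) \<partial>lborel) p * ennreal (w x)
        \<le> ennreal (A powr (p - 1)) * (\<integral>\<^sup>+ t. ennreal (K x t) \<partial>lborel)" .
  qed
  also have "\<dots> = ennreal (A powr (p - 1)) * (\<integral>\<^sup>+ x. \<integral>\<^sup>+ t. ennreal (K x t) \<partial>lborel \<partial>lborel)"
    by (rule nn_integral_cmult) measurable
  also have "(\<integral>\<^sup>+ x. \<integral>\<^sup>+ t. ennreal (K x t) \<partial>lborel \<partial>lborel)
      = (\<integral>\<^sup>+ t. \<integral>\<^sup>+ x. ennreal (K x t) \<partial>lborel \<partial>lborel)"
    by (rule lborel_pair.Fubini'[symmetric]) measurable
  also have "\<dots> \<le> (\<integral>\<^sup>+ t. ennreal (k t * b t) * ?N \<partial>lborel)"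
  proof (rule nn_integral_mono_AE, use AE_lborel_singleton[of "0 :: real"] in eventually_elim)
    case (elim t)
    \<comment> \<open>Substitute \<open>x = t * y\<close>; since \<open>b t powr p = \<bar>t\<bar> * d t\<close>, the Jacobian and the dilation factor cancel.\<close>
    have "(\<integral>\<^sup>+ x. ennreal (K x t) \<partial>lborel)
        = ennreal \<bar>t\<bar> * (\<integral>\<^sup>+ y. ennreal (K (t * y) t) \<partial>lborel)"
      by (rule nn_integral_scale) (use elim in \<open>auto simp: K_def\<close>)
    also have "\<dots> = (\<integral>\<^sup>+ y. ennreal \<bar>t\<bar> * ennreal (K (t * y) t) \<partial>lborel)"
      by (rule nn_integral_cmult[symmetric]) (simp add: K_def)
    also have "\<dots> \<le> (\<integral>\<^sup>+ y. ennreal (k t * b t) * ennreal (g y powr p * w y) \<partial>lborel)"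
    proof (rule nn_integral_mono_AE, use wd[OF elim] in eventually_elim)
      fix y assume y: "w (t * y) \<le> d t * w y"
      have "\<bar>t\<bar> * K (t * y) t = k t * b t * (g y powr p / (\<bar>t\<bar> * d t)) * (\<bar>t\<bar> * w (t * y))"
        using elim g[of y] b[OF elim] by (simp add: K_def powr_divide)
      also have "\<dots> \<le> k t * b t * (g y powr p / (\<bar>t\<bar> * d t)) * (\<bar>t\<bar> * (d t * w y))"
        using k[of t] b0[of t] d[OF elim] y by (intro mult_left_mono) auto
      also have "\<dots> = k t * b t * (g y powr p * w y)"
        using elim d[OF elim] by simp
      finally have "ennreal (\<bar>t\<bar> * K (t * y) t) \<le> ennreal (k t * b t * (g y powr p * w y))"
        by (rule ennreal_leI)
      then show "ennreal \<bar>t\<bar> * ennreal (K (t * y) t)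
          \<le> ennreal (k t * b t) * ennreal (g y powr p * w y)"
        using k[of t] b0[of t] w by (simp add: ennreal_mult K_def)
    qed
    also have "\<dots> = ennreal (k t * b t) * ?N"
      by (rule nn_integral_cmult) measurable
    finally show ?case .
  qed
  also have "\<dots> = (\<integral>\<^sup>+ t. ennreal (k t * b t) \<partial>lborel) * ?N"
    by (rule nn_integral_multc) measurable
  also have "\<dots> \<le> ennreal A * ?N"
    using kA by (intro mult_right_mono) (auto simp: b_def)
  also have "ennreal (A powr (p - 1)) * (ennreal A * ?N) = ennreal (A powr p) * ?N"
    using A by (simp add: powr_diff ennreal_mult flip: mult.assoc)
       (simp flip: ennreal_mult)
  finally show ?thesis by (simp add: mult_left_mono)
qed


section \<open>The dilation factor of a weight\<close>

lemma not_AE_lborel_False: "\<not> (AE x in (lborel :: real measure). False)"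
  using ae_filter_eq_bot_iff[of "lborel :: real measure"]
  by (simp add: trivial_limit_def)

lemma essinf_AE: "AE x in M. essinf M f \<le> f x"
proof (cases "f \<in> borel_measurable M \<and> 0 < essinf M f")
  case True
  then obtain u :: "nat \<Rightarrow> ennreal" where u: "\<And>n. u n < essinf M f" "u \<longlonglongrightarrow> essinf M f"
    using approx_from_below_dense_linorder[of 0 "essinf M f"] by auto
  have "AE x in M. u n < f x" for n
    using u(1)[of n] True less_LiminfD[of "u n" "ae_filter M" f] by (simp add: essinf_def)
  then have "AE x in M. \<forall>n. u n < f x"
    by (simp add: AE_all_countable)
  then show ?thesis
    by eventually_elim (meson LIMSEQ_le_const2 u(2) less_imp_le)
qed (auto simp: essinf_def)

lemma esssup_completion:
  assumes "f \<in> borel_measurable M"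
  shows "esssup (completion M) f = esssup M f"
  using assms by (simp add: esssup_eq_AE measurable_completion AE_completion_iff)

lemma dilation_sup_eq:
  assumes [measurable]: "w \<in> borel_measurable borel" and w: "\<And>x. 0 < w x"
    and v: "AE x in lborel. v x = ennreal (w x)" and "t \<noteq> 0"
  shows "AE y in lborel. v (t * y) / v y = ennreal (w (t * y) / w y)"
    and "dilation_sup v t = esssup lborel (\<lambda>y. ennreal (w (t * y) / w y))"
proof -
  show ae: "AE y in lborel. v (t * y) / v y = ennreal (w (t * y) / w y)"
    using v AE_lborel_scale[OF v \<open>t \<noteq> 0\<close>]
    by eventually_elim (simp add: divide_ennreal w less_imp_le)
  have meas: "(\<lambda>y. ennreal (w (t * y) / w y)) \<in> borel_measurable lborel" by measurable
  then have meas': "(\<lambda>y. ennreal (w (t * y) / w y)) \<in> borel_measurable lebesgue"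
    by (rule measurable_completion)
  have "(\<lambda>y. v (t * y) / v y) \<in> borel_measurable lebesgue"
    by (rule completion_measurable_AE_cong[OF meas']) (use ae in eventually_elim, simp)
  then have "dilation_sup v t = esssup lebesgue (\<lambda>y. ennreal (w (t * y) / w y))"
    unfolding dilation_sup_def
    by (rule esssup_AE_cong[OF _ meas']) (rule AE_completion[OF ae])
  then show "dilation_sup v t = esssup lborel (\<lambda>y. ennreal (w (t * y) / w y))"
    by (simp add: esssup_completion[OF meas])
qed

text \<open>
  The section \<open>g t\<close> has essential supremum at most \<open>a\<close> iff the set where it exceeds \<open>a\<close> is null, and
  by Fubini the measure of that set depends measurably on \<open>t\<close>.
\<close>

lemma borel_measurable_esssup_lborel:
  fixes g :: "real \<Rightarrow> real \<Rightarrow> ennreal"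
  assumes [measurable]: "(\<lambda>(t, y). g t y) \<in> borel_measurable (borel \<Otimes>\<^sub>M borel)"
  shows "(\<lambda>t. esssup lborel (g t)) \<in> borel_measurable borel"
proof (rule borel_measurableI_le)
  fix a :: ennreal
  have g: "g t \<in> borel_measurable lborel" for t by measurable
  have "esssup lborel (g t) \<le> a \<longleftrightarrow> emeasure lborel {y. a < g t y} = 0" for t
  proof -
    have "esssup lborel (g t) \<le> a \<longleftrightarrow> (AE y in lborel. g t y \<le> a)"
    proof
      assume "esssup lborel (g t) \<le> a"
      with esssup_AE[of "g t" lborel] show "AE y in lborel. g t y \<le> a"
        by (auto elim: eventually_mono)
    qed (rule esssup_I[OF g])
    also have "\<dots> \<longleftrightarrow> emeasure lborel {y. a < g t y} = 0"
      by (subst AE_iff_measurable[OF _ refl]) (use g in \<open>auto simp: not_le\<close>)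
    finally show ?thesis .
  qed
  moreover have "(\<lambda>t. emeasure lborel (Pair t -` {z. a < g (fst z) (snd z)})) \<in> borel_measurable borel"
  proof (rule lborel.measurable_emeasure_Pair)
    have "{z \<in> space (borel \<Otimes>\<^sub>M borel). a < (case z of (t, y) \<Rightarrow> g t y)} \<in> sets (borel \<Otimes>\<^sub>M borel)"
      by measurable
    then show "{z. a < g (fst z) (snd z)} \<in> sets (borel \<Otimes>\<^sub>M lborel)"
      by (simp add: space_pair_measure split_beta cong: sets_pair_measure_cong)
  qed
  then have "{t \<in> space borel. emeasure lborel {y. a < g t y} = 0} \<in> sets borel"
    by simp
  ultimately show "{t \<in> space borel. esssup lborel (g t) \<le> a} \<in> sets borel" by simp
qed

text \<open>
  If the essential supremum were infinite at some \<open>t\<close>, the hypothesis would make the essential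
  infimum infinite, so \<open>w(ty)/w(y) = \<infinity>\<close> almost everywhere; if it were zero, \<open>w(ty)\<close> would vanish
  almost everywhere. Both are absurd. The last two properties put the hypothesis in the form used
  below: \<open>w(ty)\<close> is comparable to \<open>d(t) w(y)\<close>, with a factor \<open>d\<close> that is measurable in \<open>t\<close>.
\<close>

lemma dilation_factor:
  fixes c :: real
  assumes [measurable]: "w \<in> borel_measurable borel" and w: "\<And>x. 0 < w x"
    and v: "AE x in lborel. v x = ennreal (w x)" and c: "0 < c"
    and le: "\<And>t. t \<noteq> 0 \<Longrightarrow> dilation_sup v t \<le> ennreal c * dilation_inf v t"
  obtains d :: "real \<Rightarrow> real" where "d \<in> borel_measurable borel"
    "\<And>t. t \<noteq> 0 \<Longrightarrow> dilation_sup v t = ennreal (d t)"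
    "\<And>t. t \<noteq> 0 \<Longrightarrow> 0 < d t"
    "\<And>t. t \<noteq> 0 \<Longrightarrow> AE y in lborel. w (t * y) \<le> d t * w y"
    "\<And>t. t \<noteq> 0 \<Longrightarrow> AE y in lborel. d t * w y \<le> c * w (t * y)"
proof -
  define D where "D t = esssup lborel (\<lambda>y. ennreal (w (t * y) / w y))" for t
  have [measurable]: "D \<in> borel_measurable borel"
    unfolding D_def by (rule borel_measurable_esssup_lborel) measurable
  define d where "d t = enn2real (D t)" for t
  have sup: "dilation_sup v t = D t" if "t \<noteq> 0" for t
    unfolding D_def by (rule dilation_sup_eq) (use assms that in auto)
  have up: "AE y in lborel. ennreal (w (t * y) / w y) \<le> D t" for t
    unfolding D_def by (rule esssup_AE)
  have low: "AE y in lborel. D t \<le> ennreal (c * (w (t * y) / w y))" if "t \<noteq> 0" for t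
  proof -
    have "AE y in lborel. dilation_inf v t \<le> v (t * y) / v y"
      using essinf_AE[of lebesgue] unfolding dilation_inf_def AE_completion_iff by blast
    with dilation_sup_eq(1)[OF assms(1) w v that]
    show ?thesis
    proof eventually_elim
      case (elim y)
      have "D t \<le> ennreal c * dilation_inf v t" using le[OF that] sup[OF that] by simp
      also have "\<dots> \<le> ennreal c * ennreal (w (t * y) / w y)"
        using elim by (intro mult_left_mono) auto
      also have "\<dots> = ennreal (c * (w (t * y) / w y))"
        by (rule ennreal_mult[symmetric]) (use c w[of y] w[of "t * y"] in auto)
      finally show ?case .
    qed
  qed
  have fin: "D t = ennreal (d t)" if "t \<noteq> 0" for t
  proof -
    have "D t \<noteq> \<infinity>"
    proof
      assume "D t = \<infinity>"
      with low[OF that] have "AE y in (lborel :: real measure). False" by (simp add: top_unique)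
      then show False by (simp add: not_AE_lborel_False)
    qed
    then show ?thesis by (simp add: d_def less_top)
  qed
  have up': "AE y in lborel. w (t * y) \<le> d t * w y" if "t \<noteq> 0" for t
    using up[of t]
  proof eventually_elim
    case (elim y)
    then have "w (t * y) / w y \<le> d t"
      unfolding fin[OF that] by (subst (asm) ennreal_le_iff) (simp_all add: d_def)
    then show ?case using w[of y] by (simp add: field_simps)
  qed
  have low': "AE y in lborel. d t * w y \<le> c * w (t * y)" if "t \<noteq> 0" for t
    using low[OF that]
  proof eventually_elim
    case (elim y)
    have "0 \<le> c * (w (t * y) / w y)" using c w[of y] w[of "t * y"] by simp
    with elim have "d t \<le> c * (w (t * y) / w y)"
      unfolding fin[OF that] by (subst (asm) ennreal_le_iff) simp_all
    then show ?case using w[of y] by (simp add: field_simps)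
  qed
  have pos: "0 < d t" if "t \<noteq> 0" for t
  proof (rule ccontr)
    assume "\<not> 0 < d t"
    then have "d t = 0" using enn2real_nonneg[of "D t"] unfolding d_def by linarith
    from up'[OF that] have "AE y in (lborel :: real measure). False"
    proof eventually_elim
      case (elim y)
      then show ?case using \<open>d t = 0\<close> w[of "t * y"] by simp
    qed
    then show False by (simp add: not_AE_lborel_False)
  qed
  show thesis
  proof (rule that[of d])
    show "d \<in> borel_measurable borel" unfolding d_def by measurable
    show "dilation_sup v t = ennreal (d t)" if "t \<noteq> 0" for t
      using sup[OF that] fin[OF that] by (rule trans)
  qed (fact pos up' low')+
qed


section \<open>The operator on Borel representatives\<close>

lemma weighted_norm_eq:
  assumes w: "\<And>x. 0 < w x" and v: "AE x in lborel. v x = ennreal (w x)"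
    and f: "AE x in lborel. f x = g x"
  shows "weighted_norm p v f
    = epowr (\<integral>\<^sup>+ x. ennreal (norm (g x) powr p * w x) \<partial>lborel) (1 / p)"
proof -
  have "(\<integral>\<^sup>+ x. ennreal (norm (f x) powr p) * v x \<partial>lborel)
      = (\<integral>\<^sup>+ x. ennreal (norm (g x) powr p * w x) \<partial>lborel)"
    by (rule nn_integral_cong_AE, use v f in eventually_elim)
      (simp add: ennreal_mult less_imp_le[OF w])
  then show ?thesis
    by (simp add: weighted_norm_def nn_integral_completion)
qed

text \<open>
  A weight with comparable dilations, together with Borel representatives: \<open>w\<close> for \<open>v\<close>, \<open>\<psi>\<close> for the
  absolute value of \<open>\<phi>\<close>, and the dilation factor \<open>d\<close>.
\<close>

locale dunkl_hausdorff_data =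
  fixes p \<alpha> c :: real and v :: "real \<Rightarrow> ennreal"
    and \<phi> :: "real \<Rightarrow> 'a::{real_normed_field, banach, second_countable_topology}"
    and w d \<psi> :: "real \<Rightarrow> real"
  assumes p: "1 < p" and c: "0 < c"
    and w_borel [measurable]: "w \<in> borel_measurable borel"
    and w_pos: "\<And>x. 0 < w x"
    and v_eq: "AE x in lborel. v x = ennreal (w x)"
    and \<psi>_borel [measurable]: "\<psi> \<in> borel_measurable borel"
    and \<psi>_nonneg: "\<And>t. 0 \<le> \<psi> t"
    and \<phi>_eq: "AE t in lborel. norm (\<phi> t) = \<psi> t"
    and d_borel [measurable]: "d \<in> borel_measurable borel"
    and dilation_sup_d: "\<And>t. t \<noteq> 0 \<Longrightarrow> dilation_sup v t = ennreal (d t)"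
    and d_pos: "\<And>t. t \<noteq> 0 \<Longrightarrow> 0 < d t"
    and d_upper: "\<And>t. t \<noteq> 0 \<Longrightarrow> AE y in lborel. w (t * y) \<le> d t * w y"
    and d_lower: "\<And>t. t \<noteq> 0 \<Longrightarrow> AE y in lborel. d t * w y \<le> c * w (t * y)"
begin

definition kernel :: "real \<Rightarrow> real" where
  "kernel t = \<psi> t / \<bar>t\<bar> powr (2 * \<alpha> + 2)"

definition average :: "(real \<Rightarrow> 'a) \<Rightarrow> real \<Rightarrow> 'a" where
  "average g x = (\<integral> t. kernel t *\<^sub>R g (x / t) \<partial>lborel)"

lemma kernel_borel [measurable]: "kernel \<in> borel_measurable borel"
  unfolding kernel_def by measurable

lemma kernel_nonneg: "0 \<le> kernel t"
  by (simp add: kernel_def \<psi>_nonneg)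

lemma A_sup_eq:
  "A_sup p v \<alpha> \<phi> = (\<integral>\<^sup>+ t. ennreal (kernel t * (\<bar>t\<bar> * d t) powr (1 / p)) \<partial>lborel)"
proof -
  have "(\<integral>\<^sup>+ t. ennreal (norm (\<phi> t) / \<bar>t\<bar> powr (2 * \<alpha> + 2 - 1 / p))
            * epowr (dilation_sup v t) (1 / p) \<partial>lborel)
      = (\<integral>\<^sup>+ t. ennreal (kernel t * (\<bar>t\<bar> * d t) powr (1 / p)) \<partial>lborel)"
  proof (rule nn_integral_cong_AE, use \<phi>_eq AE_lborel_singleton[of "0 :: real"] in eventually_elim)
    case (elim t)
    then show ?case
      using d_pos[OF elim(2)] \<psi>_nonneg[of t]
      by (simp add: dilation_sup_d epowr_ennreal kernel_def powr_diff powr_mult flip: ennreal_mult)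
  qed
  then show ?thesis
    by (simp add: A_sup_def nn_integral_completion)
qed

lemma dunkl_hausdorff_borel_version:
  assumes [measurable]: "g \<in> borel_measurable borel" and fg: "AE x in lborel. f x = g x"
  shows "AE x in lborel. dunkl_hausdorff \<alpha> \<phi> f x = average g x"
    and "AE x in lborel. integrable lebesgue (dunkl_hausdorff_integrand \<alpha> \<phi> f x)
      \<longleftrightarrow> integrable lborel (\<lambda>t. kernel t *\<^sub>R g (x / t))"
proof -
  have "AE x in lborel. dunkl_hausdorff \<alpha> \<phi> f x = average g x \<and>
    (integrable lebesgue (dunkl_hausdorff_integrand \<alpha> \<phi> f x)
      \<longleftrightarrow> integrable lborel (\<lambda>t. kernel t *\<^sub>R g (x / t)))"
    using AE_lborel_quotient[OF fg]
  proof eventually_elim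
    case (elim x)
    have eq: "AE t in lborel. kernel t *\<^sub>R g (x / t) = dunkl_hausdorff_integrand \<alpha> \<phi> f x t"
      using elim \<phi>_eq by eventually_elim (simp add: kernel_def dunkl_hausdorff_integrand_def)
    then have eq': "AE t in lebesgue. dunkl_hausdorff_integrand \<alpha> \<phi> f x t = kernel t *\<^sub>R g (x / t)"
      by (intro AE_completion) (simp add: eq_commute)
    have m: "(\<lambda>t. kernel t *\<^sub>R g (x / t)) \<in> borel_measurable lborel" by measurable
    have m': "dunkl_hausdorff_integrand \<alpha> \<phi> f x \<in> borel_measurable lebesgue"
      by (rule completion_measurable_AE_cong[OF measurable_completion[OF m] eq])
    show ?case
      using integral_cong_AE[OF m' measurable_completion[OF m] eq']
        integrable_cong_AE[OF m' measurable_completion[OF m] eq']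
      by (simp add: dunkl_hausdorff_def average_def integral_completion[OF m]
          integrable_completion[OF m])
  qed
  then show "AE x in lborel. dunkl_hausdorff \<alpha> \<phi> f x = average g x"
    "AE x in lborel. integrable lebesgue (dunkl_hausdorff_integrand \<alpha> \<phi> f x)
      \<longleftrightarrow> integrable lborel (\<lambda>t. kernel t *\<^sub>R g (x / t))"
    by (auto elim: eventually_mono)
qed

lemma average_borel [measurable]:
  assumes [measurable]: "g \<in> borel_measurable borel"
  shows "average g \<in> borel_measurable borel"
proof -
  have "average g \<in> borel_measurable lborel"
    unfolding average_def by measurable
  then show ?thesis by simp
qed

lemma dunkl_hausdorff_borel_measurable:
  assumes "g \<in> borel_measurable borel" "AE x in lborel. f x = g x"
  shows "dunkl_hausdorff \<alpha> \<phi> f \<in> borel_measurable lebesgue"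
proof (rule completion_measurable_AE_cong)
  show "average g \<in> borel_measurable lebesgue"
    using average_borel[OF assms(1)] by (intro measurable_completion) simp
  show "AE x in lborel. average g x = dunkl_hausdorff \<alpha> \<phi> f x"
    using dunkl_hausdorff_borel_version(1)[OF assms] by eventually_elim simp
qed

section \<open>Sufficiency and the upper bound\<close>

text \<open>
  The estimate is made for the integral of absolute values, which dominates \<open>average g\<close> even
  where the Bochner integral does not exist and takes the value 0. When \<open>g\<close> has finite norm, so
  has this integral; as \<open>w > 0\<close>, it is then finite almost everywhere, which is absolute convergence.
\<close>

lemma average_bound:
  assumes [measurable]: "g \<in> borel_measurable borel" and A: "0 < A" "A_sup p v \<alpha> \<phi> \<le> ennreal A"
  shows "(\<integral>\<^sup>+ x. ennreal (norm (average g x) powr p * w x) \<partial>lborel)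
      \<le> ennreal (A powr p) * (\<integral>\<^sup>+ y. ennreal (norm (g y) powr p * w y) \<partial>lborel)"
    and "(\<integral>\<^sup>+ y. ennreal (norm (g y) powr p * w y) \<partial>lborel) < \<infinity> \<Longrightarrow>
      AE x in lborel. integrable lborel (\<lambda>t. kernel t *\<^sub>R g (x / t))"
proof -
  define F where "F x = (\<integral>\<^sup>+ t. ennreal (kernel t * norm (g (x / t))) \<partial>lborel)" for x
  have [measurable]: "F \<in> borel_measurable borel" unfolding F_def by measurable
  have bound: "(\<integral>\<^sup>+ x. epowr (F x) p * ennreal (w x) \<partial>lborel)
      \<le> ennreal (A powr p) * (\<integral>\<^sup>+ y. ennreal (norm (g y) powr p * w y) \<partial>lborel)"
    unfolding F_def
    by (rule weighted_dilation_average_le[where d = d])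
      (use p A d_pos d_upper kernel_nonneg less_imp_le[OF w_pos] in \<open>auto simp: A_sup_eq\<close>)
  have norm_le: "ennreal (norm (average g x)) \<le> F x" for x
  proof (cases "integrable lborel (\<lambda>t. kernel t *\<^sub>R g (x / t))")
    case True
    then show ?thesis
      using integral_norm_bound_ennreal[OF True] kernel_nonneg by (simp add: average_def F_def)
  qed (simp add: average_def not_integrable_integral_eq)
  have "(\<integral>\<^sup>+ x. ennreal (norm (average g x) powr p * w x) \<partial>lborel)
      \<le> (\<integral>\<^sup>+ x. epowr (F x) p * ennreal (w x) \<partial>lborel)"
  proof (rule nn_integral_mono)
    fix x
    have "ennreal (norm (average g x) powr p * w x)
        = epowr (ennreal (norm (average g x))) p * ennreal (w x)"
      using less_imp_le[OF w_pos] by (simp add: epowr_ennreal ennreal_mult)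
    also have "\<dots> \<le> epowr (F x) p * ennreal (w x)"
      using p by (intro mult_right_mono epowr_mono norm_le) auto
    finally show "ennreal (norm (average g x) powr p * w x) \<le> epowr (F x) p * ennreal (w x)" .
  qed
  also note bound
  finally show "(\<integral>\<^sup>+ x. ennreal (norm (average g x) powr p * w x) \<partial>lborel)
      \<le> ennreal (A powr p) * (\<integral>\<^sup>+ y. ennreal (norm (g y) powr p * w y) \<partial>lborel)" .
  assume "(\<integral>\<^sup>+ y. ennreal (norm (g y) powr p * w y) \<partial>lborel) < \<infinity>"
  then have "(\<integral>\<^sup>+ x. epowr (F x) p * ennreal (w x) \<partial>lborel) \<noteq> \<infinity>"
    using bound by (auto simp: ennreal_mult_less_top less_top[symmetric] top_unique
        ennreal_mult_eq_top_iff)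
  moreover have "(\<lambda>x. epowr (F x) p * ennreal (w x)) \<in> borel_measurable lborel"
    unfolding epowr_def by measurable
  ultimately have "AE x in lborel. epowr (F x) p * ennreal (w x) \<noteq> \<infinity>"
    by (intro nn_integral_PInf_AE) auto
  then show "AE x in lborel. integrable lborel (\<lambda>t. kernel t *\<^sub>R g (x / t))"
  proof eventually_elim
    case (elim x)
    then have "epowr (F x) p < \<infinity>"
      using w_pos[of x] by (auto simp: ennreal_mult_eq_top_iff less_top)
    then have "F x < \<infinity>" by (simp only: epowr_less_top_iff)
    then show ?case
      by (intro integrableI_bounded) (simp_all add: F_def kernel_nonneg)
  qed
qed

text \<open>
  Asking for \<open>A > 0\<close> instead of taking \<open>A = A_sup\<close> avoids a separate discussion of the case
  \<open>A_sup = 0\<close>; the sharp constant is recovered as an infimum.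
\<close>

lemma dunkl_hausdorff_upper:
  assumes A: "0 < A" "A_sup p v \<alpha> \<phi> \<le> ennreal A"
  shows "dunkl_hausdorff_bounded p v \<alpha> \<phi>" and "A \<in> dunkl_hausdorff_bounds p v \<alpha> \<phi>"
proof -
  have main: "(AE x in lebesgue. integrable lebesgue (dunkl_hausdorff_integrand \<alpha> \<phi> f x)) \<and>
      dunkl_hausdorff \<alpha> \<phi> f \<in> weighted_Lp p v \<and>
      weighted_norm p v (dunkl_hausdorff \<alpha> \<phi> f) \<le> ennreal A * weighted_norm p v f"
    if f: "f \<in> weighted_Lp p v" for f
  proof -
    from f have "f \<in> borel_measurable lebesgue" and fin: "weighted_norm p v f < \<infinity>"
      by (auto simp: weighted_Lp_def)
    then obtain g where g: "g \<in> borel_measurable borel" "AE x in lborel. f x = g x"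
      by (auto elim: completion_borel_representative)
    note norm_f = weighted_norm_eq[OF w_pos v_eq g(2), of p]
    note norm_Hf = weighted_norm_eq[OF w_pos v_eq dunkl_hausdorff_borel_version(1)[OF g], of p]
    have norm: "weighted_norm p v (dunkl_hausdorff \<alpha> \<phi> f) \<le> ennreal A * weighted_norm p v f"
      unfolding norm_f norm_Hf
      using p A average_bound(1)[OF g(1) A] by (subst epowr_le_cmult_iff) auto
    have "weighted_norm p v (dunkl_hausdorff \<alpha> \<phi> f) < \<infinity>"
      using norm fin by (auto intro!: le_less_trans[OF norm] simp: ennreal_mult_less_top)
    with dunkl_hausdorff_borel_measurable[OF g]
    have "dunkl_hausdorff \<alpha> \<phi> f \<in> weighted_Lp p v" by (simp add: weighted_Lp_def)
    moreover have "AE x in lborel. integrable lborel (\<lambda>t. kernel t *\<^sub>R g (x / t))"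
      using fin unfolding norm_f epowr_less_top_iff by (rule average_bound(2)[OF g(1) A])
    with dunkl_hausdorff_borel_version(2)[OF g]
    have "AE x in lborel. integrable lebesgue (dunkl_hausdorff_integrand \<alpha> \<phi> f x)"
      by eventually_elim simp
    ultimately show ?thesis using norm by (simp add: AE_completion)
  qed
  then show "A \<in> dunkl_hausdorff_bounds p v \<alpha> \<phi>"
    using A by (auto simp: dunkl_hausdorff_bounds_def)
  with main show "dunkl_hausdorff_bounded p v \<alpha> \<phi>"
    by (auto simp: dunkl_hausdorff_bounded_def)
qed

end


section \<open>Necessity and the lower bound\<close>

text \<open>
  The \<open>p\<close>-th power of the norm of the test functions below, taken over \<open>R < \<bar>x\<bar>\<close> and with
  \<open>q = e * p\<close>. Only its scaling in \<open>R\<close> and the fact that it is positive and finite matter.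
\<close>

definition power_tail :: "real \<Rightarrow> real \<Rightarrow> ennreal" where
  "power_tail q R = (\<integral>\<^sup>+ x. ennreal (if R < \<bar>x\<bar> then \<bar>x\<bar> powr (- 1 - q) else 0) \<partial>lborel)"

lemma power_tail_scale:
  assumes "0 < R"
  shows "power_tail q R = ennreal (R powr (- q)) * power_tail q 1"
proof -
  have "power_tail q R
      = ennreal \<bar>R\<bar> * (\<integral>\<^sup>+ x. ennreal (if R < \<bar>R * x\<bar> then \<bar>R * x\<bar> powr (- 1 - q) else 0) \<partial>lborel)"
    unfolding power_tail_def by (rule nn_integral_scale) (use assms in auto)
  also have "\<dots> = (\<integral>\<^sup>+ x. ennreal \<bar>R\<bar> *
      ennreal (if R < \<bar>R * x\<bar> then \<bar>R * x\<bar> powr (- 1 - q) else 0) \<partial>lborel)"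
    by (rule nn_integral_cmult[symmetric]) measurable
  also have "\<dots> = (\<integral>\<^sup>+ x. ennreal (R powr (- q)) *
      ennreal (if 1 < \<bar>x\<bar> then \<bar>x\<bar> powr (- 1 - q) else 0) \<partial>lborel)"
  proof (rule nn_integral_cong)
    fix x :: real
    have "R * (R * \<bar>x\<bar>) powr (- 1 - q) = R powr (- q) * \<bar>x\<bar> powr (- 1 - q)"
      using assms by (simp add: powr_mult powr_diff powr_minus field_simps)
    then show "ennreal \<bar>R\<bar> * ennreal (if R < \<bar>R * x\<bar> then \<bar>R * x\<bar> powr (- 1 - q) else 0)
        = ennreal (R powr (- q)) * ennreal (if 1 < \<bar>x\<bar> then \<bar>x\<bar> powr (- 1 - q) else 0)"
      using assms by (simp add: abs_mult flip: ennreal_mult)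
  qed
  also have "\<dots> = ennreal (R powr (- q)) * power_tail q 1"
    unfolding power_tail_def by (rule nn_integral_cmult) measurable
  finally show ?thesis .
qed

text \<open>
  On the positive half-line the integrand has the antiderivative \<open>- (x powr (- q)) / q\<close>; the
  negative half-line is its reflection.
\<close>

lemma power_tail_finite:
  assumes "0 < q"
  shows "power_tail q 1 < \<infinity>"
proof -
  define u where "u x = ennreal (x powr (- 1 - q)) * indicator {1..} x" for x :: real
  have [measurable]: "u \<in> borel_measurable borel" unfolding u_def by measurable
  have "(\<integral>\<^sup>+ x. u x \<partial>lborel) = ennreal (0 - (- (1 powr (- q)) / q))"
    unfolding u_def
  proof (rule nn_integral_FTC_atLeast)
    show "DERIV (\<lambda>x. - (x powr (- q)) / q) x :> x powr (- 1 - q)" if "1 \<le> x" for x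
      using that assms by (auto intro!: derivative_eq_intros simp: powr_diff powr_minus field_simps)
    have "((\<lambda>x. x powr (- q)) \<longlongrightarrow> 0) at_top"
      by (rule tendsto_neg_powr) (use assms in \<open>auto intro: filterlim_ident\<close>)
    from tendsto_divide[OF tendsto_minus[OF this] tendsto_const, of q]
    show "((\<lambda>x. - (x powr (- q)) / q) \<longlongrightarrow> 0) at_top" using assms by simp
  qed auto
  then have fin: "(\<integral>\<^sup>+ x. u x \<partial>lborel) < \<infinity>" by simp
  have "power_tail q 1 \<le> (\<integral>\<^sup>+ x. u x + u (- x) \<partial>lborel)"
    unfolding power_tail_def by (rule nn_integral_mono) (auto simp: u_def indicator_def)
  also have "\<dots> = (\<integral>\<^sup>+ x. u x \<partial>lborel) + (\<integral>\<^sup>+ x. u (- x) \<partial>lborel)"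
    by (rule nn_integral_add) measurable
  also have "(\<integral>\<^sup>+ x. u (- x) \<partial>lborel) = (\<integral>\<^sup>+ x. u x \<partial>lborel)"
    using nn_integral_scale[of u "- 1"] by simp
  also have "(\<integral>\<^sup>+ x. u x \<partial>lborel) + (\<integral>\<^sup>+ x. u x \<partial>lborel) < \<infinity>"
    using fin by simp
  finally show ?thesis .
qed

lemma power_tail_pos:
  assumes "0 < q"
  shows "0 < power_tail q 1"
proof -
  have "0 < ennreal (3 powr (- 1 - q))" by simp
  also have "\<dots> = (\<integral>\<^sup>+ x. ennreal (3 powr (- 1 - q)) * indicator {2..3} x \<partial>(lborel :: real measure))"
    by (subst nn_integral_cmult_indicator) auto
  also have "\<dots> \<le> power_tail q 1"
    unfolding power_tail_def
  proof (rule nn_integral_mono)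
    fix x :: real
    have "3 powr (- 1 - q) \<le> x powr (- 1 - q)" if "2 \<le> x" "x \<le> 3"
      by (rule powr_mono2') (use that assms in auto)
    then show "ennreal (3 powr (- 1 - q)) * indicator {2..3} x
        \<le> ennreal (if 1 < \<bar>x\<bar> then \<bar>x\<bar> powr (- 1 - q) else 0)"
      by (auto simp: indicator_def intro!: ennreal_leI)
  qed
  finally show ?thesis .
qed

lemma ennreal_le_realI:
  assumes "\<And>\<tau>. 0 \<le> \<tau> \<Longrightarrow> ennreal \<tau> \<le> T \<Longrightarrow> \<tau> \<le> K"
  shows "T \<le> ennreal K"
proof (rule dense_le)
  fix x assume "x < T"
  then show "x \<le> ennreal K"
  proof (cases x)
    case (real \<tau>)
    with assms[of \<tau>] \<open>x < T\<close> show ?thesis by (simp add: ennreal_leI)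
  qed simp
qed

context dunkl_hausdorff_data
begin

text \<open>
  The factor \<open>w powr (- 1 / p)\<close> cancels the weight in the norm, and \<open>\<bar>x\<bar> powr (- 1 / p)\<close> is the borderline
  decay for integrability. The perturbation \<open>e\<close> and the cut-off at \<open>1\<close> bring the function into the
  weighted space.
\<close>

definition profile :: "real \<Rightarrow> real \<Rightarrow> real" where
  "profile e x = (if 1 < \<bar>x\<bar> then w x powr (- 1 / p) * \<bar>x\<bar> powr (- 1 / p - e) else 0)"

lemma profile_borel [measurable]: "profile e \<in> borel_measurable borel"
  unfolding profile_def by measurable

lemma profile_nonneg: "0 \<le> profile e x"
  by (simp add: profile_def)

lemma profile_decay:
  "(w x powr (- 1 / p) * \<bar>x\<bar> powr (- 1 / p - e)) powr p * w x = \<bar>x\<bar> powr (- 1 - e * p)"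
proof -
  have exponents: "- 1 / p * p = - 1" "(- 1 / p - e) * p = - 1 - e * p"
    using p by (simp_all add: field_simps)
  have "(w x powr (- 1 / p) * \<bar>x\<bar> powr (- 1 / p - e)) powr p * w x
      = w x powr (- 1) * \<bar>x\<bar> powr (- 1 - e * p) * w x"
    by (subst powr_mult) (simp_all only: powr_powr exponents powr_ge_zero)
  then show ?thesis using w_pos[of x] by (simp add: powr_neg_one)
qed

lemma profile_norm:
  "(\<integral>\<^sup>+ x. ennreal (norm (of_real (profile e x) :: 'a) powr p * w x) \<partial>lborel)
    = power_tail (e * p) 1"
  unfolding power_tail_def
proof (rule nn_integral_cong, rule arg_cong[where f = ennreal])
  fix x
  show "norm (of_real (profile e x) :: 'a) powr p * w x
      = (if 1 < \<bar>x\<bar> then \<bar>x\<bar> powr (- 1 - e * p) else 0)"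
    using profile_decay[of x e] by (simp add: profile_def)
qed

text \<open>
  The test function is nearly an eigenfunction of the dilation by \<open>t\<close>: since \<open>w(x/t)\<close> is at most
  \<open>c * w x / d t\<close>, the dilated profile is at least \<open>w x powr (- 1 / p) * \<bar>x\<bar> powr (- 1 / p - e)\<close> times
  \<open>(\<bar>t\<bar> * d t / c) powr (1 / p) * \<bar>t\<bar> powr e\<close>. The conditions \<open>\<bar>t\<bar> < R < \<bar>x\<bar>\<close> keep \<open>x / t\<close> outside the cut-off.
\<close>

lemma profile_quotient_ge:
  assumes "t \<noteq> 0" "\<bar>t\<bar> < R" "R < \<bar>x\<bar>" and le: "d t * w (x / t) \<le> c * w x"
  shows "c powr (- 1 / p) * w x powr (- 1 / p) * \<bar>x\<bar> powr (- 1 / p - e)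
      * ((\<bar>t\<bar> * d t) powr (1 / p) * \<bar>t\<bar> powr e) \<le> profile e (x / t)"
proof -
  have x: "x \<noteq> 0" and big: "1 < \<bar>x / t\<bar>"
    using assms by (auto simp: field_simps)
  have "w (x / t) \<le> c * w x / d t"
    using le d_pos[OF assms(1)] by (simp add: field_simps)
  then have "(c * w x / d t) powr (- 1 / p) \<le> w (x / t) powr (- 1 / p)"
    using p w_pos[of "x / t"] by (intro powr_mono2') auto
  then have "(c * w x / d t) powr (- 1 / p) * \<bar>x / t\<bar> powr (- 1 / p - e) \<le> profile e (x / t)"
    using big by (simp add: profile_def mult_right_mono)
  moreover have "(c * w x / d t) powr (- 1 / p)
      = c powr (- 1 / p) * w x powr (- 1 / p) * d t powr (1 / p)"
    using c w_pos[of x] d_pos[OF assms(1)]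
    by (simp add: powr_mult powr_divide powr_minus field_simps)
  moreover have "\<bar>x / t\<bar> powr (- 1 / p - e)
      = \<bar>x\<bar> powr (- 1 / p - e) * (\<bar>t\<bar> powr (1 / p) * \<bar>t\<bar> powr e)"
    using assms(1) x
    by (simp add: powr_divide powr_diff powr_minus abs_divide field_simps)
  moreover have "(\<bar>t\<bar> * d t) powr (1 / p) = \<bar>t\<bar> powr (1 / p) * d t powr (1 / p)"
    using d_pos[OF assms(1)] by (simp add: powr_mult)
  ultimately show ?thesis by (simp add: mult_ac)
qed

lemma AE_d_lower_quotient:
  "AE x in lborel. AE t in lborel. d t * w (x / t) \<le> c * w x"
proof (rule AE_lborel_commute[rotated])
  show "AE t in lborel. AE x in lborel. d t * w (x / t) \<le> c * w x"
    using AE_lborel_singleton[of "0 :: real"]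
  proof eventually_elim
    case (elim t)
    then show ?case
      using AE_lborel_scale[OF d_lower[OF elim], of "1 / t"] by simp
  qed
qed measurable

text \<open>
  Testing the bound \<open>C\<close> on the profile and keeping only \<open>R < \<bar>x\<bar>\<close> on the left, both sides are multiples
  of the same tail integral, the left one carrying the factor \<open>R powr (- (e * p))\<close>; cancelling it
  leaves the claim. The integral is replaced by real numbers \<open>\<tau>\<close> below it because it is not yet
  known to be finite.
\<close>

lemma truncated_lower_bound:
  assumes bdd: "dunkl_hausdorff_bounded p v \<alpha> \<phi>" and C: "C \<in> dunkl_hausdorff_bounds p v \<alpha> \<phi>"
    and e: "0 < e" and R: "0 < R"
  shows "(\<integral>\<^sup>+ t. ennreal (if \<bar>t\<bar> < R then kernel t * (\<bar>t\<bar> * d t) powr (1 / p) * \<bar>t\<bar> powr e else 0) \<partial>lborel)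
    \<le> ennreal (c powr (1 / p) * C * R powr e)" (is "(\<integral>\<^sup>+ t. ennreal (?k t) \<partial>lborel) \<le> _")
proof (rule ennreal_le_realI)
  fix \<tau> :: real assume \<tau>: "0 \<le> \<tau>" "ennreal \<tau> \<le> (\<integral>\<^sup>+ t. ennreal (?k t) \<partial>lborel)"
  define f where "f x = (of_real (profile e x) :: 'a)" for x
  have [measurable]: "f \<in> borel_measurable borel"
    unfolding f_def by measurable
  have C0: "0 \<le> C" using C by (simp add: dunkl_hausdorff_bounds_def)
  have ep: "0 < e * p" using e p by simp
  note norm_f = weighted_norm_eq[OF w_pos v_eq, of f f p, simplified, unfolded f_def profile_norm,
      folded f_def]
  have "f \<in> borel_measurable lebesgue" by (intro measurable_completion) simp
  then have fLp: "f \<in> weighted_Lp p v"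
    using power_tail_finite[OF ep]
    by (simp add: weighted_Lp_def norm_f epowr_less_top_iff[simplified])
  have version: "AE x in lborel. dunkl_hausdorff \<alpha> \<phi> f x = average f x"
    "AE x in lborel. integrable lebesgue (dunkl_hausdorff_integrand \<alpha> \<phi> f x)
      \<longleftrightarrow> integrable lborel (\<lambda>t. kernel t *\<^sub>R f (x / t))"
    using dunkl_hausdorff_borel_version[of f f] by auto
  have int: "AE x in lborel. integrable lborel (\<lambda>t. kernel t *\<^sub>R f (x / t))"
  proof -
    have "AE x in lborel. integrable lebesgue (dunkl_hausdorff_integrand \<alpha> \<phi> f x)"
      using bdd fLp unfolding dunkl_hausdorff_bounded_def AE_completion_iff by blast
    with version(2) show ?thesis by eventually_elim simp
  qed
  have "weighted_norm p v (dunkl_hausdorff \<alpha> \<phi> f) \<le> ennreal C * weighted_norm p v f"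
    using C fLp by (simp add: dunkl_hausdorff_bounds_def)
  then have upper: "(\<integral>\<^sup>+ x. ennreal (norm (average f x) powr p * w x) \<partial>lborel)
      \<le> ennreal (C powr p) * power_tail (e * p) 1"
    unfolding norm_f weighted_norm_eq[OF w_pos v_eq version(1)]
    using p C0 by (subst (asm) epowr_le_cmult_iff) auto
  define u where "u x = c powr (- 1 / p) * w x powr (- 1 / p) * \<bar>x\<bar> powr (- 1 / p - e)" for x
  have u0: "0 \<le> u x" for x by (simp add: u_def)
  \<comment> \<open>Near infinity the operator multiplies the profile, up to \<open>c powr (- 1 / p)\<close>, by at least \<open>\<tau>\<close>.\<close>
  have "AE x in lborel. R < \<bar>x\<bar> \<longrightarrow> u x * \<tau> \<le> norm (average f x)"
    using int AE_d_lower_quotient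
  proof eventually_elim
    case (elim x)
    show ?case
    proof
      assume x: "R < \<bar>x\<bar>"
      have norm: "norm (kernel t *\<^sub>R f (x / t)) = kernel t * profile e (x / t)" for t
        by (simp add: f_def kernel_nonneg profile_nonneg)
      have int_real: "integrable lborel (\<lambda>t. kernel t * profile e (x / t))"
        using integrable_norm[OF elim(1)] unfolding norm .
      have "average f x = of_real (\<integral> t. kernel t * profile e (x / t) \<partial>lborel)"
        using int_real
        by (simp add: average_def f_def scaleR_conv_of_real flip: of_real_mult)
      then have norm_avg: "norm (average f x) = (\<integral> t. kernel t * profile e (x / t) \<partial>lborel)"
        by (simp add: kernel_nonneg profile_nonneg)
      have "ennreal (u x * \<tau>) \<le> ennreal (u x) * (\<integral>\<^sup>+ t. ennreal (?k t) \<partial>lborel)"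
        using \<tau> u0 by (simp add: ennreal_mult mult_left_mono)
      also have "\<dots> = (\<integral>\<^sup>+ t. ennreal (u x) * ennreal (?k t) \<partial>lborel)"
        by (rule nn_integral_cmult[symmetric]) measurable
      also have "\<dots> \<le> (\<integral>\<^sup>+ t. ennreal (kernel t * profile e (x / t)) \<partial>lborel)"
      proof (rule nn_integral_mono_AE, use elim(2) AE_lborel_singleton[of "0 :: real"] in eventually_elim)
        case (elim t)
        have "u x * ?k t \<le> kernel t * profile e (x / t)"
        proof (cases "\<bar>t\<bar> < R")
          case True
          have "kernel t * (u x * ((\<bar>t\<bar> * d t) powr (1 / p) * \<bar>t\<bar> powr e))
              \<le> kernel t * profile e (x / t)"
            unfolding u_def
            by (intro mult_left_mono profile_quotient_ge[where R = R] elim True x kernel_nonneg)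
          then show ?thesis using True by (simp add: mult_ac)
        qed (simp add: kernel_nonneg profile_nonneg)
        then have "ennreal (u x * ?k t) \<le> ennreal (kernel t * profile e (x / t))"
          by (rule ennreal_leI)
        then show ?case
          by (subst ennreal_mult[symmetric]) (auto simp: u0 kernel_nonneg)
      qed
      also have "\<dots> = ennreal (norm (average f x))"
        unfolding norm_avg
        by (rule nn_integral_eq_integral[OF int_real]) (simp add: kernel_nonneg profile_nonneg)
      finally show "u x * \<tau> \<le> norm (average f x)" by simp
    qed
  qed
  then have "AE x in lborel. ennreal (\<tau> powr p / c) *
      ennreal (if R < \<bar>x\<bar> then \<bar>x\<bar> powr (- 1 - e * p) else 0)
      \<le> ennreal (norm (average f x) powr p * w x)"
  proof eventually_elim
    case (elim x)
    show ?case
    proof (cases "R < \<bar>x\<bar>")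
      case True
      have "u x powr p * w x = \<bar>x\<bar> powr (- 1 - e * p) / c"
      proof -
        have "(c powr (- 1 / p)) powr p = 1 / c"
          using p c by (simp add: powr_powr powr_neg_one)
        then have "u x powr p * w x = 1 / c *
            ((w x powr (- 1 / p) * \<bar>x\<bar> powr (- 1 / p - e)) powr p * w x)"
          unfolding u_def mult.assoc by (subst powr_mult) simp_all
        then show ?thesis unfolding profile_decay by simp
      qed
      then have "\<tau> powr p / c * \<bar>x\<bar> powr (- 1 - e * p) = \<tau> powr p * (u x powr p * w x)"
        by simp
      also have "\<dots> = (u x * \<tau>) powr p * w x"
        using u0[of x] \<tau>(1) by (simp add: powr_mult mult_ac)
      also have "\<dots> \<le> norm (average f x) powr p * w x"
        using elim True p u0[of x] \<tau>(1) less_imp_le[OF w_pos[of x]]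
        by (intro mult_right_mono powr_mono2) auto
      finally have "ennreal (\<tau> powr p / c * \<bar>x\<bar> powr (- 1 - e * p))
          \<le> ennreal (norm (average f x) powr p * w x)" by (rule ennreal_leI)
      then show ?thesis using True c by (subst ennreal_mult[symmetric]) auto
    qed simp
  qed
  then have "(\<integral>\<^sup>+ x. ennreal (\<tau> powr p / c) *
      ennreal (if R < \<bar>x\<bar> then \<bar>x\<bar> powr (- 1 - e * p) else 0) \<partial>lborel)
      \<le> (\<integral>\<^sup>+ x. ennreal (norm (average f x) powr p * w x) \<partial>lborel)"
    by (rule nn_integral_mono_AE)
  also note upper
  also have "(\<integral>\<^sup>+ x. ennreal (\<tau> powr p / c) *
      ennreal (if R < \<bar>x\<bar> then \<bar>x\<bar> powr (- 1 - e * p) else 0) \<partial>lborel)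
      = ennreal (\<tau> powr p / c) * power_tail (e * p) R"
    unfolding power_tail_def by (rule nn_integral_cmult) measurable
  also have "\<dots> = ennreal (\<tau> powr p / c * R powr (- (e * p))) * power_tail (e * p) 1"
    by (simp only: power_tail_scale[OF R] mult.assoc[symmetric])
      (subst ennreal_mult, use c in auto)
  finally have "ennreal (\<tau> powr p / c * R powr (- (e * p))) * power_tail (e * p) 1
      \<le> ennreal (C powr p) * power_tail (e * p) 1" .
  then have "ennreal (\<tau> powr p / c * R powr (- (e * p))) \<le> ennreal (C powr p)"
    using power_tail_finite[OF ep] power_tail_pos[OF ep]
    by (simp add: mult.commute[of _ "power_tail (e * p) 1"] ennreal_mult_le_mult_iff)
  then have "\<tau> powr p / c * R powr (- (e * p)) \<le> C powr p"
    by simp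
  then have "\<tau> powr p \<le> c * C powr p * R powr (e * p)"
    using c R by (simp add: powr_minus field_simps)
  also have "\<dots> = (c powr (1 / p) * C * R powr e) powr p"
    using p c C0 by (simp add: powr_mult powr_powr)
  finally have "\<tau> powr p \<le> (c powr (1 / p) * C * R powr e) powr p" .
  then show "\<tau> \<le> c powr (1 / p) * C * R powr e"
    using p C0 powr_less_mono2[of p "c powr (1 / p) * C * R powr e" \<tau>] by force
qed

text \<open>
  Take \<open>R = n + 1\<close> and \<open>e = 1 / (n + 1)\<close> in the truncated bound. The integrand becomes that of
  \<open>A_sup\<close> multiplied by \<open>(\<bar>t\<bar> / R) powr e\<close> on \<open>\<bar>t\<bar> < R\<close>; this factor tends to \<open>1\<close> because the \<open>n\<close>-th roots of \<open>n\<close> and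
  of a positive constant do, so Fatou's lemma applies.
\<close>

lemma A_sup_le_bound:
  assumes bdd: "dunkl_hausdorff_bounded p v \<alpha> \<phi>" and C: "C \<in> dunkl_hausdorff_bounds p v \<alpha> \<phi>"
  shows "A_sup p v \<alpha> \<phi> \<le> ennreal (c powr (1 / p) * C)"
proof -
  define h where "h t = kernel t * (\<bar>t\<bar> * d t) powr (1 / p)" for t
  have [measurable]: "h \<in> borel_measurable borel" unfolding h_def by measurable
  define r where "r n t = (\<bar>t\<bar> / real (Suc n)) powr (1 / real (Suc n))" for n and t :: real
  have [measurable]: "r n \<in> borel_measurable borel" for n unfolding r_def by measurable
  define hn where "hn n t = ennreal (if \<bar>t\<bar> < real (Suc n) then h t * r n t else 0)" for n t
  have [measurable]: "hn n \<in> borel_measurable lborel" for n unfolding hn_def by measurable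
  have r_lim: "(\<lambda>n. r n t) \<longlonglongrightarrow> 1" if "t \<noteq> 0" for t
  proof -
    have "(\<lambda>n. root (Suc n) \<bar>t\<bar> / root (Suc n) (real (Suc n))) \<longlonglongrightarrow> 1 / 1"
      by (intro tendsto_divide LIMSEQ_Suc[OF LIMSEQ_root_const] LIMSEQ_Suc[OF LIMSEQ_root])
        (use that in auto)
    moreover have "root (Suc n) \<bar>t\<bar> / root (Suc n) (real (Suc n)) = r n t" for n
      using that unfolding r_def by (subst (1 2) root_powr_inverse) (auto simp: powr_divide)
    ultimately show ?thesis by simp
  qed
  have hn_lim: "(\<lambda>n. hn n t) \<longlonglongrightarrow> ennreal (h t)" if "t \<noteq> 0" for t
  proof -
    have "\<forall>\<^sub>F n in sequentially. \<bar>t\<bar> < real n"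
      using filterlim_real_sequentially unfolding filterlim_at_top_dense by blast
    then have "\<forall>\<^sub>F n in sequentially. ennreal (h t * r n t) = hn n t"
      by eventually_elim (simp add: hn_def)
    moreover have "(\<lambda>n. ennreal (h t * r n t)) \<longlonglongrightarrow> ennreal (h t * 1)"
      by (intro tendsto_ennrealI tendsto_mult tendsto_const r_lim that)
    ultimately show ?thesis by (auto elim: Lim_transform_eventually[rotated])
  qed
  have hn_le: "(\<integral>\<^sup>+ t. hn n t \<partial>lborel) \<le> ennreal (c powr (1 / p) * C)" for n
  proof -
    define e where "e = 1 / real (Suc n)"
    define R where "R = real (Suc n)"
    have eR: "0 < e" "0 < R" by (auto simp: e_def R_def)
    have "hn n t = ennreal (R powr (- e)) *
        ennreal (if \<bar>t\<bar> < R then kernel t * (\<bar>t\<bar> * d t) powr (1 / p) * \<bar>t\<bar> powr e else 0)" for t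
    proof -
      have "r n t = R powr (- e) * \<bar>t\<bar> powr e"
        unfolding r_def unfolding e_def[symmetric] unfolding R_def[symmetric]
        using eR by (simp add: powr_divide powr_minus field_simps)
      then show ?thesis
        unfolding hn_def R_def[symmetric]
        by (subst ennreal_mult[symmetric]) (auto simp: h_def kernel_nonneg mult_ac)
    qed
    then have "(\<integral>\<^sup>+ t. hn n t \<partial>lborel) = ennreal (R powr (- e)) *
        (\<integral>\<^sup>+ t. ennreal (if \<bar>t\<bar> < R then kernel t * (\<bar>t\<bar> * d t) powr (1 / p) * \<bar>t\<bar> powr e else 0) \<partial>lborel)"
      by (simp add: nn_integral_cmult)
    also have "\<dots> \<le> ennreal (R powr (- e)) * ennreal (c powr (1 / p) * C * R powr e)"
      by (intro mult_left_mono truncated_lower_bound bdd C eR) auto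
    also have "\<dots> = ennreal (c powr (1 / p) * C)"
      using C eR by (simp add: dunkl_hausdorff_bounds_def powr_minus flip: ennreal_mult)
    finally show ?thesis .
  qed
  have "A_sup p v \<alpha> \<phi> = (\<integral>\<^sup>+ t. ennreal (h t) \<partial>lborel)"
    by (simp add: A_sup_eq h_def)
  also have "\<dots> \<le> (\<integral>\<^sup>+ t. liminf (\<lambda>n. hn n t) \<partial>lborel)"
  proof (rule nn_integral_mono_AE, use AE_lborel_singleton[of "0 :: real"] in eventually_elim)
    case (elim t)
    then show ?case using lim_imp_Liminf[OF _ hn_lim[OF elim]] by simp
  qed
  also have "\<dots> \<le> liminf (\<lambda>n. \<integral>\<^sup>+ t. hn n t \<partial>lborel)"
    by (rule nn_integral_liminf) measurable
  also have "\<dots> \<le> ennreal (c powr (1 / p) * C)"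
    by (rule order_trans[OF Liminf_mono[where g = "\<lambda>_. ennreal (c powr (1 / p) * C)"]])
      (auto simp: hn_le Liminf_const)
  finally show ?thesis .
qed

lemma one_le_c: "1 \<le> c"
proof (rule ccontr)
  assume "\<not> 1 \<le> c"
  have "AE y in (lborel :: real measure). False"
    using d_upper[of 1, simplified] d_lower[of 1, simplified]
  proof eventually_elim
    case (elim y)
    then have "1 * w y \<le> c * w y" by linarith
    then have "1 \<le> c" using w_pos[of y] by (subst (asm) mult_le_cancel_right_pos) auto
    with \<open>\<not> 1 \<le> c\<close> show False by simp
  qed
  then show False by (simp add: not_AE_lborel_False)
qed

lemma dunkl_hausdorff_lower:
  assumes bdd: "dunkl_hausdorff_bounded p v \<alpha> \<phi>"
  shows "A_sup p v \<alpha> \<phi> < \<infinity>"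
    and "ennreal (1 / c) * A_sup p v \<alpha> \<phi> \<le> dunkl_hausdorff_norm p v \<alpha> \<phi>"
proof -
  have le: "ennreal (1 / c) * A_sup p v \<alpha> \<phi> \<le> ennreal C"
    if C: "C \<in> dunkl_hausdorff_bounds p v \<alpha> \<phi>" for C
  proof -
    have C0: "0 \<le> C" using C by (simp add: dunkl_hausdorff_bounds_def)
    have "c powr (1 / p) \<le> c powr 1"
      by (rule powr_mono) (use p one_le_c in auto)
    then have "c powr (1 / p) * C \<le> c * C"
      using c C0 by (intro mult_right_mono) auto
    with A_sup_le_bound[OF bdd C] have "A_sup p v \<alpha> \<phi> \<le> ennreal (c * C)"
      by (meson ennreal_leI order_trans)
    then have "ennreal (1 / c) * A_sup p v \<alpha> \<phi> \<le> ennreal (1 / c) * ennreal (c * C)"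
      by (rule mult_left_mono) simp
    also have "\<dots> = ennreal C" using c C0 by (simp flip: ennreal_mult)
    finally show ?thesis .
  qed
  then show "ennreal (1 / c) * A_sup p v \<alpha> \<phi> \<le> dunkl_hausdorff_norm p v \<alpha> \<phi>"
    using bdd by (auto simp: dunkl_hausdorff_norm_def intro: INF_greatest)
  obtain C where "C \<in> dunkl_hausdorff_bounds p v \<alpha> \<phi>"
    using bdd by (auto simp: dunkl_hausdorff_bounded_def)
  from A_sup_le_bound[OF bdd this] show "A_sup p v \<alpha> \<phi> < \<infinity>"
    by (rule le_less_trans) simp
qed

lemma dunkl_hausdorff_norm_le: "dunkl_hausdorff_norm p v \<alpha> \<phi> \<le> A_sup p v \<alpha> \<phi>"
proof (rule dense_ge)
  fix y assume y: "A_sup p v \<alpha> \<phi> < y"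
  show "dunkl_hausdorff_norm p v \<alpha> \<phi> \<le> y"
  proof (cases y)
    case (real A)
    with le_less_trans[OF zero_le y] y have "0 < A" "A_sup p v \<alpha> \<phi> \<le> ennreal A"
      by auto
    from dunkl_hausdorff_upper[OF this] show ?thesis
      using real by (auto simp: dunkl_hausdorff_norm_def intro: INF_lower)
  qed simp
qed

lemma dunkl_hausdorff_bounded_iff:
  "dunkl_hausdorff_bounded p v \<alpha> \<phi> \<longleftrightarrow> A_sup p v \<alpha> \<phi> < \<infinity>"
proof
  assume "A_sup p v \<alpha> \<phi> < \<infinity>"
  then obtain A where "A_sup p v \<alpha> \<phi> = ennreal A" "0 \<le> A" by (cases "A_sup p v \<alpha> \<phi>") auto
  then show "dunkl_hausdorff_bounded p v \<alpha> \<phi>"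
    by (intro dunkl_hausdorff_upper(1)[of "A + 1"]) (auto intro: ennreal_leI)
qed (rule dunkl_hausdorff_lower(1))

lemma dunkl_hausdorff_norm_ge:
  "ennreal (1 / c) * A_sup p v \<alpha> \<phi> \<le> dunkl_hausdorff_norm p v \<alpha> \<phi>"
proof (cases "dunkl_hausdorff_bounded p v \<alpha> \<phi>")
  case False
  then show ?thesis by (simp add: dunkl_hausdorff_norm_def)
qed (rule dunkl_hausdorff_lower(2))

end

theorem theorem2p3:
  fixes p \<alpha> c :: real
    and v :: "real \<Rightarrow> ennreal"
    and \<phi> :: "real \<Rightarrow> 'a::{real_normed_field, banach, second_countable_topology}"
  assumes "1 < p"
    and "weight_function v"
    and "integrable lebesgue \<phi>"
    and "c > 0"
    and "\<forall>t. t \<noteq> 0 \<longrightarrow> dilation_sup v t \<le> ennreal c * dilation_inf v t"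
  shows "(dunkl_hausdorff_bounded p v \<alpha> \<phi> \<longleftrightarrow> A_sup p v \<alpha> \<phi> < \<infinity>) \<and>
    ennreal (1 / c) * A_sup p v \<alpha> \<phi> \<le> dunkl_hausdorff_norm p v \<alpha> \<phi> \<and>
    dunkl_hausdorff_norm p v \<alpha> \<phi> \<le> A_sup p v \<alpha> \<phi>"
proof -
  obtain w :: "real \<Rightarrow> real" where w: "w \<in> borel_measurable borel" "\<And>x. 0 < w x"
    "AE x in lborel. v x = ennreal (w x)"
    using weight_borel_version[OF assms(2)] by blast
  obtain d :: "real \<Rightarrow> real" where d: "d \<in> borel_measurable borel"
    "\<And>t. t \<noteq> 0 \<Longrightarrow> dilation_sup v t = ennreal (d t)"
    "\<And>t. t \<noteq> 0 \<Longrightarrow> 0 < d t"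
    "\<And>t. t \<noteq> 0 \<Longrightarrow> AE y in lborel. w (t * y) \<le> d t * w y"
    "\<And>t. t \<noteq> 0 \<Longrightarrow> AE y in lborel. d t * w y \<le> c * w (t * y)"
    using dilation_factor[OF w assms(4)] assms(5) by blast
  obtain \<eta> where \<eta>: "\<eta> \<in> borel_measurable lborel" "AE t in lborel. \<phi> t = \<eta> t"
    using completion_borel_representative[OF borel_measurable_integrable[OF assms(3)]] by blast
  interpret dunkl_hausdorff_data p \<alpha> c v \<phi> w d "\<lambda>t. norm (\<eta> t)"
  proof
    show "(\<lambda>t. norm (\<eta> t)) \<in> borel_measurable borel" using \<eta>(1) by simp
    show "AE t in lborel. norm (\<phi> t) = norm (\<eta> t)" using \<eta>(2) by eventually_elim simp
  qed (use assms w d in auto)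
  show ?thesis
    using dunkl_hausdorff_bounded_iff dunkl_hausdorff_norm_ge dunkl_hausdorff_norm_le by blast
qed

end
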